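(* Let $\theta:[a,b]\to\mathbb R$ be stationary for the functional $\mathcal E$ with free boundaries, such that $V_\theta(\theta(a))\neq0$, $V_\theta(\theta(b))\neq 0$, and there is no $s\in[a,b]$ with $\theta'(s)=0$ and $V_\theta(\theta(s))=0$. Let $\gamma:[a,b]\to\mathbb R^2$, $\gamma(s)=(\theta(s),\theta'(s))$, be the associated phase-plane trajectory, and let $J[\gamma]$ be its index. Then: (1) if $J[\gamma]>0$, $\theta$ is not locally minimal for $\mathcal E$ on $\mathcal D^N([a,b])$; (2) if $J[\gamma]<0$, $\theta$ is locally minimal for $\mathcal E$ on $\mathcal D^N([a,b])$.
   Context: Let $a<b$ be real numbers, $A\in\mathbb R$, and let $V:\mathbb R\to\mathbb R$ be of class $C^2$ such that $V_\theta=dV/d\theta$ and $V_{\theta\theta}=d^2V/d\theta^2$ have no common zero. For $\theta\in C^1([a,b])$ set $\mathcal E[\theta]=\int_a^b\left(\frac{(\theta'(s)-A)^2}{2}-V(\theta(s))\right)ds$. Free boundaries: no values of $\theta$ are prescribed at $a,b$. Let $\mathcal C^N([a,b])=\{\tau\in C^1([a,b]):\tau'(a)=\tau'(b)=0\}\setminus\{0\}$ and $\mathcal D^N([a,b])=\{\tau\in C^2([a,b])\setminus\{0\}:\tau'(a)=\tau'(b)=0\}$. $\theta$ is stationary if $\frac{d}{d\epsilon}\mathcal E[\theta+\epsilon\tau]|_{\epsilon=0}=0$ for all $\tau\in\mathcal C^N([a,b])$; equivalently, $\theta$ is a $C^2$ solution of $\theta''(s)+V_\theta(\theta(s))=0$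 on $[a,b]$ with $\theta'(a)=\theta'(b)=A$. $\theta$ is locally minimal for $\mathcal E$ on a set $\mathcal P$ of perturbations if for every $\tau\in\mathcal P$ there exists $M>0$ such that $\mathcal E[\theta+\epsilon\tau]>\mathcal E[\theta]$ for all $\epsilon\in[-M,M]\setminus\{0\}$. Let $\Gamma_m=\{(x,y)\in\mathbb R^2: V_\theta(x)=0,\ V_{\theta\theta}(x)>0\}$ and $\Gamma_M=\{(x,y)\in\mathbb R^2: V_\theta(x)=0,\ V_{\theta\theta}(x)<0\}$. The index is $J[\gamma]=\#\{s\in[a,b]:\gamma(s)\in\Gamma_m\}-\#\{s\in[a,b]:\gamma(s)\in\Gamma_M\}$. *)

theory Defs
  imports "HOL-Analysis.Analysis"
begin

text \<open>
  Functions on \<open>[a,b]\<close> are total functions of which only the values on \<open>{a..b}\<close> matter.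
  Hence derivatives are taken within \<open>{a..b}\<close> (one-sided at the end points), and
  ``nonzero'' means not identically zero on \<open>{a..b}\<close>.
\<close>

definition deriv_on :: "real \<Rightarrow> real \<Rightarrow> (real \<Rightarrow> real) \<Rightarrow> real \<Rightarrow> real" where
  "deriv_on a b f s = vector_derivative f (at s within {a..b})"

definition C1_on :: "real \<Rightarrow> real \<Rightarrow> (real \<Rightarrow> real) set" where
  "C1_on a b = {f. f differentiable_on {a..b} \<and> continuous_on {a..b} (deriv_on a b f)}"

definition C2_on :: "real \<Rightarrow> real \<Rightarrow> (real \<Rightarrow> real) set" where
  "C2_on a b = {f \<in> C1_on a b. deriv_on a b f \<in> C1_on a b}"

definition C2_real :: "(real \<Rightarrow> real) \<Rightarrow> bool" where
  "C2_real V \<longleftrightarrow> V differentiable_on UNIV \<and> deriv V differentiable_on UNIV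
     \<and> continuous_on UNIV (deriv (deriv V))"

definition energy :: "real \<Rightarrow> real \<Rightarrow> real \<Rightarrow> (real \<Rightarrow> real) \<Rightarrow> (real \<Rightarrow> real) \<Rightarrow> real" where
  "energy a b A V \<theta> = integral {a..b} (\<lambda>s. (deriv_on a b \<theta> s - A)\<^sup>2 / 2 - V (\<theta> s))"

definition CN :: "real \<Rightarrow> real \<Rightarrow> (real \<Rightarrow> real) set" where
  "CN a b = {\<tau> \<in> C1_on a b. deriv_on a b \<tau> a = 0 \<and> deriv_on a b \<tau> b = 0
     \<and> (\<exists>s\<in>{a..b}. \<tau> s \<noteq> 0)}"

definition DN :: "real \<Rightarrow> real \<Rightarrow> (real \<Rightarrow> real) set" where
  "DN a b = {\<tau> \<in> C2_on a b. deriv_on a b \<tau> a = 0 \<and> deriv_on a b \<tau> b = 0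
     \<and> (\<exists>s\<in>{a..b}. \<tau> s \<noteq> 0)}"

definition stationary_free :: "real \<Rightarrow> real \<Rightarrow> real \<Rightarrow> (real \<Rightarrow> real) \<Rightarrow> (real \<Rightarrow> real) \<Rightarrow> bool" where
  "stationary_free a b A V \<theta> \<longleftrightarrow> \<theta> \<in> C1_on a b \<and>
     (\<forall>\<tau>\<in>CN a b. ((\<lambda>\<epsilon>. energy a b A V (\<lambda>s. \<theta> s + \<epsilon> * \<tau> s)) has_real_derivative 0) (at 0))"

definition locally_minimal ::
  "real \<Rightarrow> real \<Rightarrow> real \<Rightarrow> (real \<Rightarrow> real) \<Rightarrow> (real \<Rightarrow> real) set \<Rightarrow> (real \<Rightarrow> real) \<Rightarrow> bool" where
  "locally_minimal a b A V P \<theta> \<longleftrightarrow>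
     (\<forall>\<tau>\<in>P. \<exists>M>0. \<forall>\<epsilon>\<in>{-M..M} - {0}.
        energy a b A V (\<lambda>s. \<theta> s + \<epsilon> * \<tau> s) > energy a b A V \<theta>)"

definition Gamma_m :: "(real \<Rightarrow> real) \<Rightarrow> (real \<times> real) set" where
  "Gamma_m V = {(x, y). deriv V x = 0 \<and> deriv (deriv V) x > 0}"

definition Gamma_M :: "(real \<Rightarrow> real) \<Rightarrow> (real \<times> real) set" where
  "Gamma_M V = {(x, y). deriv V x = 0 \<and> deriv (deriv V) x < 0}"

definition phase_traj :: "real \<Rightarrow> real \<Rightarrow> (real \<Rightarrow> real) \<Rightarrow> real \<Rightarrow> real \<times> real" where
  "phase_traj a b \<theta> s = (\<theta> s, deriv_on a b \<theta> s)"

text \<open>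
  Since \<^const>\<open>card\<close> is 0 on infinite sets, this is the intended number only for finitely many
  crossings. That is automatic when \<open>V\<close> is \<open>C\<^sup>2\<close>, \<open>V'\<close> and \<open>V''\<close> have no common zero, and \<open>\<theta>\<close> is
  \<open>C\<^sup>1\<close> with \<open>\<theta>' \<noteq> 0\<close> wherever \<open>V'(\<theta>) = 0\<close>: the zeros of \<open>V'(\<theta>)\<close> are then isolated
  in the compact interval.
\<close>

definition index :: "real \<Rightarrow> real \<Rightarrow> (real \<Rightarrow> real) \<Rightarrow> (real \<Rightarrow> real \<times> real) \<Rightarrow> int" where
  "index a b V \<gamma> = int (card {s \<in> {a..b}. \<gamma> s \<in> Gamma_m V}) - int (card {s \<in> {a..b}. \<gamma> s \<in> Gamma_M V})"

end

theory Submission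
  imports Defs
begin

text \<open>
  Along a stationary \<open>\<theta>\<close> the second derivative of \<open>\<epsilon> \<mapsto> energy (\<theta> + \<epsilon> \<tau>)\<close> at \<open>0\<close> is
  \<open>Q(\<tau>) = \<integral> \<tau>'\<^sup>2 - q \<tau>\<^sup>2\<close> with \<open>q = V''(\<theta>)\<close>, so it suffices to show that \<open>Q\<close> is positive on
  all of \<open>DN\<close> when the index \<open>J\<close> is negative, and negative somewhere on \<open>DN\<close> when \<open>J\<close> is positive
  (\<open>second_variation_sign\<close>). By the Euler--Lagrange equation, \<open>u = \<theta>'\<close> satisfies \<open>u'' + q u = 0\<close>,
  \<open>u' = - V'(\<theta>)\<close> and \<open>u a = u b = A\<close>.

  The index is computed from the function \<open>p = u V'(\<theta>) = - u u'\<close>, with \<open>p' = q u\<^sup>2 - V'(\<theta>)\<^sup>2\<close>.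
  Its zeros are simple: at a zero of \<open>V'(\<theta>)\<close> the sign of \<open>p'\<close> is that of \<open>q\<close>, which is the sign with
  which this zero enters \<open>J\<close>, and at a zero of \<open>u\<close> it is negative. Counting signed zeros
  (\<open>sum_sgn_simple_zeros\<close>) gives
  \<open>2 J = sgn (p b) - sgn (p a) + \<Sum>\<close>, where the sum is over the zeros of \<open>u\<close>,
  each counted twice in the interior and once at an end point (\<open>index_identity\<close>).

  If \<open>J < 0\<close>, this forces \<open>u\<close> to have no zero, with \<open>u u' < 0\<close> at \<open>a\<close> and \<open>u u' > 0\<close> at \<open>b\<close>. Then
  \<open>Q(\<tau>) = \<integral> (\<tau>' - (u'/u) \<tau>)\<^sup>2 + [(u'/u) \<tau>\<^sup>2]\<close>, with the bracket evaluated from \<open>a\<close> to \<open>b\<close>,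
  is positive (\<open>jacobi_form_pos\<close>).

  If \<open>J > 0\<close> and \<open>u\<close> has no zero, then \<open>Q(u) = [u u'] < 0\<close>. If \<open>u\<close> has a zero, it has
  two zeros \<open>c < d\<close>, because \<open>u a = u b\<close>; the truncation of \<open>u\<close> to \<open>[c,d]\<close> has \<open>Q = 0\<close>, and adding a
  small multiple of \<open>s - c\<close> makes \<open>Q\<close> negative. These test functions need not lie in \<open>DN\<close>; their
  derivatives are approximated pointwise and boundedly by \<open>C\<^sup>1\<close> functions vanishing at the end points,
  and \<open>Q\<close> converges by dominated convergence (\<open>truncated_negative_imp_DN_negative\<close>).
\<close>

section \<open>Derivatives within a compact interval\<close>

lemma deriv_on_eq:
  assumes "a < b" "s \<in> {a..b}" "(f has_real_derivative D) (at s within {a..b})"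
  shows "deriv_on a b f s = D"
  unfolding deriv_on_def
  using assms vector_derivative_within_closed_interval[of a b s f D]
  by (simp add: has_real_derivative_iff_has_vector_derivative)

lemma C1_on_has_deriv:
  assumes "f \<in> C1_on a b" "s \<in> {a..b}"
  shows "(f has_real_derivative deriv_on a b f s) (at s within {a..b})"
  using assms unfolding C1_on_def differentiable_on_def deriv_on_def
  by (simp add: has_real_derivative_iff_has_vector_derivative vector_derivative_works[symmetric])

lemma C1_on_continuous_deriv: "f \<in> C1_on a b \<Longrightarrow> continuous_on {a..b} (deriv_on a b f)"
  by (simp add: C1_on_def)

lemma has_deriv_continuous_on:
  fixes f f' :: "real \<Rightarrow> real"
  assumes "\<And>s. s \<in> S \<Longrightarrow> (f has_real_derivative f' s) (at s within S)"
  shows "continuous_on S f"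
  using assms DERIV_continuous continuous_on_eq_continuous_within by blast

lemma has_real_derivative_eq_on:
  fixes f g :: "real \<Rightarrow> real"
  assumes "s \<in> S" "\<And>x. x \<in> S \<Longrightarrow> g x = f x" "(f has_real_derivative D) (at s within S)"
  shows "(g has_real_derivative D) (at s within S)"
  using has_derivative_transform[OF assms(1,2)] assms(3)
  by (simp add: has_field_derivative_def)

lemma deriv_on_zero:
  assumes "a < b" "s \<in> {a..b}" "\<forall>x\<in>{a..b}. f x = 0"
  shows "deriv_on a b f s = 0"
  by (rule deriv_on_eq[OF assms(1,2)], rule has_real_derivative_eq_on[OF assms(2), of _ "\<lambda>_. 0"])
     (use assms(3) in auto)

lemma C1_onI:
  assumes "a < b" "\<And>s. s \<in> {a..b} \<Longrightarrow> (f has_real_derivative f' s) (at s within {a..b})"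
    and "continuous_on {a..b} f'"
  shows "f \<in> C1_on a b"
proof -
  have "continuous_on {a..b} (deriv_on a b f)"
    using assms(3) by (rule continuous_on_eq) (simp add: deriv_on_eq[OF assms(1) _ assms(2)])
  moreover have "f differentiable_on {a..b}"
    unfolding differentiable_on_def real_differentiable_def using assms(2) by blast
  ultimately show ?thesis by (simp add: C1_on_def)
qed

lemma C2_onI:
  assumes "a < b" "\<And>s. s \<in> {a..b} \<Longrightarrow> (f has_real_derivative f' s) (at s within {a..b})"
    and f': "\<And>s. s \<in> {a..b} \<Longrightarrow> (f' has_real_derivative f'' s) (at s within {a..b})"
    and "continuous_on {a..b} f''"
  shows "f \<in> C2_on a b"
proof -
  have "(deriv_on a b f has_real_derivative f'' s) (at s within {a..b})" if "s \<in> {a..b}" for s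
    by (rule has_real_derivative_eq_on[OF that _ f'[OF that]])
       (simp add: deriv_on_eq[OF assms(1) _ assms(2)])
  then have "deriv_on a b f \<in> C1_on a b"
    by (rule C1_onI[OF assms(1) _ assms(4)])
  moreover have "f \<in> C1_on a b"
    by (rule C1_onI[OF assms(1,2) has_deriv_continuous_on[OF f']])
  ultimately show ?thesis by (simp add: C2_on_def)
qed

section \<open>Signed count of simple zeros\<close>

lemma sgn_near_simple_zero:
  fixes p :: "real \<Rightarrow> real"
  assumes "(p has_real_derivative D) (at z within S)" "p z = 0" "D \<noteq> 0"
  shows "\<forall>\<^sub>F s in at z within S. sgn (p s) = sgn D * sgn (s - z)"
proof -
  have lim: "((\<lambda>y. (p y - p z) / (y - z)) \<longlongrightarrow> D) (at z within S)"
    using assms(1) by (simp add: has_field_derivative_iff)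
  have "\<forall>\<^sub>F y in at z within S. sgn ((p y - p z) / (y - z)) = sgn D"
  proof (cases "D > 0")
    case True
    show ?thesis using order_tendstoD(1)[OF lim True] by eventually_elim (simp only: sgn_pos True)
  next
    case False
    then have "D < 0" using assms(3) by simp
    show ?thesis using order_tendstoD(2)[OF lim \<open>D < 0\<close>]
      by eventually_elim (simp only: sgn_neg \<open>D < 0\<close>)
  qed
  moreover have "\<forall>\<^sub>F y in at z within S. y \<noteq> z"
    by (simp add: eventually_at_filter)
  ultimately show ?thesis
    by eventually_elim (use assms(2) in \<open>auto simp: sgn_if divide_simps split: if_splits\<close>)
qed

lemma sgn_near_nonzero:
  fixes p :: "real \<Rightarrow> real"
  assumes "(p has_real_derivative D) (at z within S)" "p z \<noteq> 0"
  shows "\<forall>\<^sub>F s in at z within S. sgn (p s) = sgn (p z)"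
proof -
  have lim: "(p \<longlongrightarrow> p z) (at z within S)"
    using DERIV_continuous[OF assms(1)] by (simp add: continuous_within)
  show ?thesis
  proof (cases "p z > 0")
    case True
    show ?thesis using order_tendstoD(1)[OF lim True] by eventually_elim (use True in auto)
  next
    case False
    then have "p z < 0" using assms(2) by simp
    show ?thesis using order_tendstoD(2)[OF lim \<open>p z < 0\<close>]
      by eventually_elim (use \<open>p z < 0\<close> in auto)
  qed
qed

lemma finite_simple_zeros:
  fixes p :: "real \<Rightarrow> real"
  assumes deriv: "\<And>s. s \<in> {a..b} \<Longrightarrow> (p has_real_derivative p' s) (at s within {a..b})"
    and simple: "\<And>s. s \<in> {a..b} \<Longrightarrow> p s = 0 \<Longrightarrow> p' s \<noteq> 0"
  shows "finite {s\<in>{a..b}. p s = 0}"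
proof -
  have "\<not> z islimpt {s\<in>{a..b}. p s = 0}" if z: "z \<in> {a..b}" for z
  proof -
    have "\<forall>\<^sub>F s in at z within {a..b}. p s \<noteq> 0"
    proof (cases "p z = 0")
      case True
      have "\<forall>\<^sub>F y in at z within {a..b}. y \<noteq> z"
        by (simp add: eventually_at_filter)
      then show ?thesis
        using sgn_near_simple_zero[OF deriv[OF z] True simple[OF z True]]
        by eventually_elim (use simple[OF z True] in \<open>auto simp: sgn_if split: if_splits\<close>)
    next
      case False
      show ?thesis using sgn_near_nonzero[OF deriv[OF z] False]
        by eventually_elim (use False in \<open>auto simp: sgn_if split: if_splits\<close>)
    qed
    then show ?thesis
      unfolding islimpt_iff_eventually eventually_at_filter
      by (auto elim: eventually_mono)
  qed
  then have "finite ({a..b} \<inter> {s\<in>{a..b}. p s = 0})"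
    by (intro finite_not_islimpt_in_compact) auto
  then show ?thesis by (rule rev_finite_subset) auto
qed

text \<open>
  The weight \<open>sgn (b - z) - sgn (a - z)\<close> is \<open>2\<close> at interior zeros and, if \<open>a < b\<close>, it is \<open>1\<close> at the end
  points, so no condition on \<open>p a\<close> and \<open>p b\<close> is needed.
\<close>

lemma sum_sgn_simple_zeros:
  fixes p :: "real \<Rightarrow> real"
  assumes "a \<le> b"
    and deriv: "\<And>s. s \<in> {a..b} \<Longrightarrow> (p has_real_derivative p' s) (at s within {a..b})"
    and simple: "\<And>s. s \<in> {a..b} \<Longrightarrow> p s = 0 \<Longrightarrow> p' s \<noteq> 0"
  shows "(\<Sum>z | z \<in> {a..b} \<and> p z = 0. sgn (p' z) * (sgn (b - z) - sgn (a - z)))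
         = sgn (p b) - sgn (p a)"
proof -
  define Z where "Z = {z\<in>{a..b}. p z = 0}"
  \<comment> \<open>At a zero \<open>z\<close> the summand of \<open>z\<close> and \<open>sgn \<circ> p\<close> have the same jump, so \<open>F\<close> is locally constant.\<close>
  define F where "F s = (\<Sum>z\<in>Z. sgn (p' z) * sgn (s - z)) - sgn (p s)" for s
  have fin: "finite Z"
    unfolding Z_def by (rule finite_simple_zeros[OF deriv simple])
  have local: "\<forall>\<^sub>F s in at x within {a..b}. F x = F s" if x: "x \<in> {a..b}" for x
  proof -
    have away: "\<forall>\<^sub>F s in at x within {a..b}. \<forall>z\<in>Z - {x}. sgn (s - z) = sgn (x - z)"
    proof (intro eventually_ball_finite ballI)
      fix z assume "z \<in> Z - {x}"
      then show "\<forall>\<^sub>F s in at x within {a..b}. sgn (s - z) = sgn (x - z)"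
        by (intro sgn_near_nonzero[where D = 1]) (auto intro!: derivative_eq_intros)
    qed (use fin in simp)
    show ?thesis
    proof (cases "p x = 0")
      case True
      then have "x \<in> Z" using x by (simp add: Z_def)
      have split: "F s = sgn (p' x) * sgn (s - x) - sgn (p s)
                     + (\<Sum>z\<in>Z - {x}. sgn (p' z) * sgn (s - z))" for s
        unfolding F_def by (subst sum.remove[OF fin \<open>x \<in> Z\<close>]) simp
      show ?thesis
        using away sgn_near_simple_zero[OF deriv[OF x] True simple[OF x True]]
        by eventually_elim (simp add: split True)
    next
      case False
      then have "Z - {x} = Z" by (auto simp: Z_def)
      show ?thesis
        using away sgn_near_nonzero[OF deriv[OF x] False]
        by eventually_elim (simp add: F_def \<open>Z - {x} = Z\<close>)
    qed
  qed
  have "F b = F a"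
    using connected_local_const[of "{a..b}" b a F] local assms(1) by auto
  then show ?thesis
    by (simp add: F_def Z_def right_diff_distrib sum_subtractf)
qed

section \<open>First and second variation\<close>

lemma second_derivative_test:
  fixes G G' :: "real \<Rightarrow> real"
  assumes G: "\<And>e. (G has_real_derivative G' e) (at e)"
    and "G' 0 = 0" "(G' has_real_derivative D) (at 0)" "D > 0"
  shows "\<exists>M>0. \<forall>e\<in>{-M..M} - {0}. G e > G 0"
proof -
  obtain d1 where d1: "d1 > 0" "\<And>h. 0 < h \<Longrightarrow> h < d1 \<Longrightarrow> G' h > 0"
    using DERIV_pos_inc_right[OF assms(3,4)] assms(2) by auto
  obtain d2 where d2: "d2 > 0" "\<And>h. 0 < h \<Longrightarrow> h < d2 \<Longrightarrow> G' (- h) < 0"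
    using DERIV_pos_inc_left[OF assms(3,4)] assms(2) by auto
  define M where "M = min d1 d2 / 2"
  have M: "M > 0" "M < d1" "M < d2" using d1(1) d2(1) by (auto simp: M_def min_def)
  have "G e > G 0" if e: "e \<in> {-M..M} - {0}" for e
  proof (cases "e > 0")
    case True
    obtain z where z: "0 < z" "z < e" "G e - G 0 = (e - 0) * G' z"
      using MVT2[OF True G] by blast
    have "G' z > 0" using z e M by (intro d1) auto
    then have "(e - 0) * G' z > 0" using True by simp
    then show ?thesis using z by linarith
  next
    case False
    then have "e < 0" using e by auto
    obtain z where z: "e < z" "z < 0" "G 0 - G e = (0 - e) * G' z"
      using MVT2[OF \<open>e < 0\<close> G] by blast
    have "G' (- (- z)) < 0" using z e M by (intro d2) auto
    then have "(0 - e) * G' z < 0" using \<open>e < 0\<close> by (intro mult_pos_neg) auto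
    then show ?thesis using z by linarith
  qed
  then show ?thesis using M by blast
qed

lemma C2_real_derivs:
  assumes "C2_real V"
  shows "(V has_real_derivative deriv V x) (at x)"
    and "(deriv V has_real_derivative deriv (deriv V) x) (at x)"
    and "continuous_on UNIV V" "continuous_on UNIV (deriv V)" "continuous_on UNIV (deriv (deriv V))"
  using assms unfolding C2_real_def
  by (auto simp: DERIV_deriv_iff_real_differentiable differentiable_on_def
      intro: differentiable_imp_continuous_on[unfolded differentiable_on_def])

text \<open>
  For \<open>\<theta>\<close> and \<open>\<tau>\<close> of class \<open>C\<^sup>1\<close>, the function \<open>\<epsilon> \<mapsto> energy (\<theta> + \<epsilon> \<tau>)\<close> is differentiable, and its derivative is
  differentiable at \<open>0\<close>, where it has as derivative the quadratic form of the linearised equation \<open>\<tau>'' + V''(\<theta>) \<tau> = 0\<close>.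
\<close>

lemma energy_variation:
  fixes A :: real
  assumes "a < b" "C2_real V" and \<theta>: "\<theta> \<in> C1_on a b" and \<tau>: "\<tau> \<in> C1_on a b"
  defines "G' \<equiv> \<lambda>e. integral {a..b} (\<lambda>s. (deriv_on a b \<theta> s + e * deriv_on a b \<tau> s - A) * deriv_on a b \<tau> s
                    - deriv V (\<theta> s + e * \<tau> s) * \<tau> s)"
  shows "((\<lambda>e. energy a b A V (\<lambda>s. \<theta> s + e * \<tau> s)) has_real_derivative G' e) (at e)"
    and "(G' has_real_derivative integral {a..b} (\<lambda>s. (deriv_on a b \<tau> s)\<^sup>2
           - deriv (deriv V) (\<theta> s) * (\<tau> s)\<^sup>2)) (at 0)"
proof -
  note V = C2_real_derivs[OF assms(2)]
  define t where "t = deriv_on a b \<theta>"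
  define r where "r = deriv_on a b \<tau>"
  have ct: "continuous_on {a..b} t" and cr: "continuous_on {a..b} r"
    using \<theta> \<tau> by (auto simp: t_def r_def C1_on_def)
  have c\<theta>: "continuous_on {a..b} \<theta>" and c\<tau>: "continuous_on {a..b} \<tau>"
    using has_deriv_continuous_on C1_on_has_deriv \<theta> \<tau> by meson+
  have snd: "continuous_on (UNIV \<times> {a..b}) (\<lambda>x. f (snd x))"
    if "continuous_on {a..b} f" for f :: "real \<Rightarrow> real"
    by (rule continuous_on_compose2[OF that]) (auto intro: continuous_intros)
  have comp: "continuous_on S (\<lambda>x. W (h x))"
    if "continuous_on UNIV W" "continuous_on S h"
    for W :: "real \<Rightarrow> real" and S :: "'b::topological_space set" and h
    by (rule continuous_on_compose2[OF that]) auto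
  have en: "energy a b A V (\<lambda>s. \<theta> s + e * \<tau> s)
      = integral {a..b} (\<lambda>s. (t s + e * r s - A)\<^sup>2 / 2 - V (\<theta> s + e * \<tau> s))" for e
    unfolding energy_def
  proof (rule integral_cong)
    fix s assume s: "s \<in> {a..b}"
    have "deriv_on a b (\<lambda>s. \<theta> s + e * \<tau> s) s = t s + e * r s"
      using C1_on_has_deriv[OF \<theta> s] C1_on_has_deriv[OF \<tau> s]
      by (intro deriv_on_eq[OF assms(1) s]) (auto simp: t_def r_def intro!: derivative_eq_intros)
    then show "(deriv_on a b (\<lambda>s. \<theta> s + e * \<tau> s) s - A)\<^sup>2 / 2 - V (\<theta> s + e * \<tau> s)
        = (t s + e * r s - A)\<^sup>2 / 2 - V (\<theta> s + e * \<tau> s)" by simp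
  qed
  have 1: "((\<lambda>e. integral (cbox a b) (\<lambda>s. (t s + e * r s - A)\<^sup>2 / 2 - V (\<theta> s + e * \<tau> s)))
     has_real_derivative integral (cbox a b) (\<lambda>s. (t s + e * r s - A) * r s - deriv V (\<theta> s + e * \<tau> s) * \<tau> s))
     (at e within UNIV)" for e
  proof (rule leibniz_rule_field_derivative)
    show "((\<lambda>e. (t s + e * r s - A)\<^sup>2 / 2 - V (\<theta> s + e * \<tau> s)) has_real_derivative
        (t s + e * r s - A) * r s - deriv V (\<theta> s + e * \<tau> s) * \<tau> s) (at e within UNIV)" for e s
      using V(1) by (auto intro!: derivative_eq_intros DERIV_chain2[where f = V])
    show "(\<lambda>s. (t s + e * r s - A)\<^sup>2 / 2 - V (\<theta> s + e * \<tau> s)) integrable_on cbox a b" for e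
      by (intro integrable_continuous)
         (auto intro!: continuous_intros ct cr c\<theta> c\<tau> comp[OF V(3)])
    show "continuous_on (UNIV \<times> cbox a b) (\<lambda>(e, s). (t s + e * r s - A) * r s - deriv V (\<theta> s + e * \<tau> s) * \<tau> s)"
      by (auto simp: case_prod_beta intro!: continuous_intros snd ct cr c\<theta> c\<tau> comp[OF V(4)])
  qed auto
  have 2: "((\<lambda>e. integral (cbox a b) (\<lambda>s. (t s + e * r s - A) * r s - deriv V (\<theta> s + e * \<tau> s) * \<tau> s))
     has_real_derivative integral (cbox a b) (\<lambda>s. (r s)\<^sup>2 - deriv (deriv V) (\<theta> s + 0 * \<tau> s) * (\<tau> s)\<^sup>2))
     (at 0 within UNIV)"
  proof (rule leibniz_rule_field_derivative)
    show "((\<lambda>e. (t s + e * r s - A) * r s - deriv V (\<theta> s + e * \<tau> s) * \<tau> s) has_real_derivative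
        (r s)\<^sup>2 - deriv (deriv V) (\<theta> s + e * \<tau> s) * (\<tau> s)\<^sup>2) (at e within UNIV)" for e s
      using V(2) by (auto intro!: derivative_eq_intros DERIV_chain2[where f = "deriv V"] simp: power2_eq_square)
    show "(\<lambda>s. (t s + e * r s - A) * r s - deriv V (\<theta> s + e * \<tau> s) * \<tau> s) integrable_on cbox a b" for e
      by (intro integrable_continuous)
         (auto intro!: continuous_intros ct cr c\<theta> c\<tau> comp[OF V(4)])
    show "continuous_on (UNIV \<times> cbox a b) (\<lambda>(e, s). (r s)\<^sup>2 - deriv (deriv V) (\<theta> s + e * \<tau> s) * (\<tau> s)\<^sup>2)"
      by (auto simp: case_prod_beta intro!: continuous_intros snd ct cr c\<theta> c\<tau> comp[OF V(5)])
  qed auto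
  show "((\<lambda>e. energy a b A V (\<lambda>s. \<theta> s + e * \<tau> s)) has_real_derivative G' e) (at e)"
    using 1 by (simp add: en G'_def t_def r_def)
  show "(G' has_real_derivative integral {a..b} (\<lambda>s. (deriv_on a b \<tau> s)\<^sup>2
           - deriv (deriv V) (\<theta> s) * (\<tau> s)\<^sup>2)) (at 0)"
    using 2 by (simp add: G'_def t_def r_def)
qed

lemma second_variation_sign:
  fixes A :: real
  assumes "a < b" "C2_real V" "\<theta> \<in> C1_on a b" "\<tau> \<in> C1_on a b"
    and crit: "((\<lambda>e. energy a b A V (\<lambda>s. \<theta> s + e * \<tau> s)) has_real_derivative 0) (at 0)"
  defines "Q \<equiv> integral {a..b} (\<lambda>s. (deriv_on a b \<tau> s)\<^sup>2 - deriv (deriv V) (\<theta> s) * (\<tau> s)\<^sup>2)"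
  shows "Q > 0 \<Longrightarrow> \<exists>M>0. \<forall>e\<in>{-M..M} - {0}. energy a b A V (\<lambda>s. \<theta> s + e * \<tau> s) > energy a b A V \<theta>"
    and "Q < 0 \<Longrightarrow> \<exists>M>0. \<forall>e\<in>{-M..M} - {0}. energy a b A V (\<lambda>s. \<theta> s + e * \<tau> s) < energy a b A V \<theta>"
proof -
  note var = energy_variation[OF assms(1-4), where A = A]
  note zero = DERIV_unique[OF var(1) crit]
  show "\<exists>M>0. \<forall>e\<in>{-M..M} - {0}. energy a b A V (\<lambda>s. \<theta> s + e * \<tau> s) > energy a b A V \<theta>" if "Q > 0"
    using second_derivative_test[OF var(1) zero var(2)] that by (simp add: Q_def)
  show "\<exists>M>0. \<forall>e\<in>{-M..M} - {0}. energy a b A V (\<lambda>s. \<theta> s + e * \<tau> s) < energy a b A V \<theta>" if "Q < 0"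
    using second_derivative_test[OF DERIV_minus[OF var(1)] _ DERIV_minus[OF var(2)]] zero that
    by (simp add: Q_def)
qed

section \<open>The Euler--Lagrange equation\<close>

lemma stationary_free_weak:
  assumes "a < b" "C2_real V" "stationary_free a b A V \<theta>"
    and "\<And>s. s \<in> {a..b} \<Longrightarrow> (\<tau> has_real_derivative r s) (at s within {a..b})"
    and "continuous_on {a..b} r" "r a = 0" "r b = 0"
  shows "integral {a..b} (\<lambda>s. (deriv_on a b \<theta> s - A) * r s - deriv V (\<theta> s) * \<tau> s) = 0"
proof -
  have \<theta>: "\<theta> \<in> C1_on a b" using assms(3) by (simp add: stationary_free_def)
  have \<tau>: "\<tau> \<in> C1_on a b" using C1_onI assms(1,4,5) by blast
  have r: "deriv_on a b \<tau> s = r s" if "s \<in> {a..b}" for s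
    using deriv_on_eq[OF assms(1) that assms(4)[OF that]] .
  have "integral {a..b} (\<lambda>s. (deriv_on a b \<theta> s + 0 * deriv_on a b \<tau> s - A) * deriv_on a b \<tau> s
          - deriv V (\<theta> s + 0 * \<tau> s) * \<tau> s) = 0"
  proof (cases "\<exists>s\<in>{a..b}. \<tau> s \<noteq> 0")
    case True
    then have "\<tau> \<in> CN a b" using \<tau> r assms(1,6,7) by (simp add: CN_def)
    then have "((\<lambda>e. energy a b A V (\<lambda>s. \<theta> s + e * \<tau> s)) has_real_derivative 0) (at 0)"
      using assms(3) by (simp add: stationary_free_def)
    then show ?thesis
      using DERIV_unique[OF energy_variation(1)[OF assms(1,2) \<theta> \<tau>]] by blast
  next
    case False
    then have "deriv_on a b \<tau> s = 0" if "s \<in> {a..b}" for s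
      using deriv_on_zero[OF assms(1) that] by blast
    then have "integral {a..b} (\<lambda>s. (deriv_on a b \<theta> s + 0 * deriv_on a b \<tau> s - A) * deriv_on a b \<tau> s
          - deriv V (\<theta> s + 0 * \<tau> s) * \<tau> s) = integral {a..b} (\<lambda>s. 0)"
      using False by (intro integral_cong) auto
    then show ?thesis by simp
  qed
  moreover have "integral {a..b} (\<lambda>s. (deriv_on a b \<theta> s + 0 * deriv_on a b \<tau> s - A) * deriv_on a b \<tau> s
          - deriv V (\<theta> s + 0 * \<tau> s) * \<tau> s)
      = integral {a..b} (\<lambda>s. (deriv_on a b \<theta> s - A) * r s - deriv V (\<theta> s) * \<tau> s)"
    by (rule integral_cong) (simp add: r)
  ultimately show ?thesis by simp
qed

text \<open>
  The argument of du Bois-Reymond: with \<open>W\<close> the primitive of \<open>V'(\<theta>)\<close> that vanishes at \<open>a\<close>, the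
  function \<open>m = \<theta>' - A + W\<close> vanishes. The constant variation yields \<open>W b = 0\<close>, which gives the
  natural boundary condition at \<open>b\<close>.
\<close>

lemma stationary_free_Euler_Lagrange:
  assumes "a < b" "C2_real V" "stationary_free a b A V \<theta>"
  shows "deriv_on a b \<theta> a = A" "deriv_on a b \<theta> b = A"
    and "s \<in> {a..b} \<Longrightarrow> (deriv_on a b \<theta> has_real_derivative - deriv V (\<theta> s)) (at s within {a..b})"
proof -
  note V = C2_real_derivs[OF assms(2)]
  note weak = stationary_free_weak[OF assms]
  have \<theta>: "\<theta> \<in> C1_on a b" using assms(3) by (simp add: stationary_free_def)
  define t where "t = deriv_on a b \<theta>"
  have ct: "continuous_on {a..b} t"
    using \<theta> by (auto simp: t_def C1_on_def)
  have c\<theta>: "continuous_on {a..b} \<theta>"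
    using has_deriv_continuous_on C1_on_has_deriv \<theta> by meson
  have cg: "continuous_on {a..b} (\<lambda>s. deriv V (\<theta> s))"
    by (rule continuous_on_compose2[OF V(4) c\<theta>]) auto
  define W where "W s = integral {a..s} (\<lambda>s. deriv V (\<theta> s))" for s
  have W: "(W has_real_derivative deriv V (\<theta> s)) (at s within {a..b})" if "s \<in> {a..b}" for s
    unfolding W_def using integral_has_real_derivative[OF cg that] .
  have cW: "continuous_on {a..b} W" by (rule has_deriv_continuous_on[OF W])
  have Wa: "W a = 0" by (simp add: W_def)
  have Wb: "W b = 0"
    using weak[of "\<lambda>_. 1" "\<lambda>_. 0"] by (simp add: W_def)
  define m where "m s = t s - A + W s" for s
  have cm: "continuous_on {a..b} m"
    unfolding m_def by (intro continuous_intros ct cW)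
  \<comment> \<open>The factor \<open>(s - a) (b - s)\<close> makes the derivative of the variation vanish at the end points.\<close>
  define r where "r s = (s - a) * (b - s) * m s" for s
  have cr: "continuous_on {a..b} r" unfolding r_def by (intro continuous_intros cm)
  define \<tau> where "\<tau> s = integral {a..s} r" for s
  have \<tau>: "(\<tau> has_real_derivative r s) (at s within {a..b})" if "s \<in> {a..b}" for s
    unfolding \<tau>_def using integral_has_real_derivative[OF cr that] .
  have c\<tau>: "continuous_on {a..b} \<tau>" by (rule has_deriv_continuous_on[OF \<tau>])
  have 0: "((\<lambda>s. (t s - A) * r s - deriv V (\<theta> s) * \<tau> s) has_integral 0) {a..b}"
  proof -
    have "(\<lambda>s. (t s - A) * r s - deriv V (\<theta> s) * \<tau> s) integrable_on {a..b}"
      by (intro integrable_continuous_real continuous_intros ct cr cg c\<tau>)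
    then show ?thesis
      using weak[OF \<tau> cr] integrable_integral by (fastforce simp: t_def r_def)
  qed
  have "((\<lambda>s. W s * r s + deriv V (\<theta> s) * \<tau> s) has_integral W b * \<tau> b - W a * \<tau> a) {a..b}"
    using assms(1) W \<tau>
    by (intro fundamental_theorem_of_calculus)
       (auto simp: has_real_derivative_iff_has_vector_derivative[symmetric] intro!: derivative_eq_intros)
  from has_integral_add[OF 0 this] have "((\<lambda>s. (s - a) * (b - s) * (m s)\<^sup>2) has_integral 0) {a..b}"
    by (simp add: Wa Wb m_def r_def algebra_simps power2_eq_square)
  then have "integral {a..b} (\<lambda>s. (s - a) * (b - s) * (m s)\<^sup>2) = 0"
    by (rule integral_unique)
  then have "\<forall>s\<in>{a..b}. (s - a) * (b - s) * (m s)\<^sup>2 = 0"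
    by (subst (asm) integral_eq_0_iff) (use assms(1) in \<open>auto intro!: continuous_intros cm\<close>)
  then have "m s = 0" if "s \<in> {a<..<b}" for s
    using that by force
  then have m0: "m s = 0" if "s \<in> {a..b}" for s
    using continuous_constant_on_closure[of "{a<..<b}" m 0 s] that assms(1) cm
    by auto
  show "deriv_on a b \<theta> a = A" "deriv_on a b \<theta> b = A"
    using m0[of a] m0[of b] assms(1) Wa Wb by (auto simp: m_def t_def)
  show "(deriv_on a b \<theta> has_real_derivative - deriv V (\<theta> s)) (at s within {a..b})"
    if s: "s \<in> {a..b}"
  proof (rule has_real_derivative_eq_on[OF s, where f = "\<lambda>s. A - W s"])
    show "deriv_on a b \<theta> x = A - W x" if "x \<in> {a..b}" for x
      using m0[OF that] by (simp add: m_def t_def)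
    show "((\<lambda>s. A - W s) has_real_derivative - deriv V (\<theta> s)) (at s within {a..b})"
      using W[OF s] by (auto intro!: derivative_eq_intros)
  qed
qed

section \<open>Positivity from a nowhere vanishing solution\<close>

text \<open>
  The quotient \<open>\<rho> = u'/u\<close> solves the Riccati equation \<open>\<rho>' = - q - \<rho>\<^sup>2\<close>, hence
  \<open>(\<rho> \<tau>\<^sup>2)' = \<tau>'\<^sup>2 - q \<tau>\<^sup>2 - (\<tau>' - \<rho> \<tau>)\<^sup>2\<close>.
\<close>

lemma jacobi_form_pos:
  assumes "a < b"
    and u: "\<And>s. s \<in> {a..b} \<Longrightarrow> (u has_real_derivative v s) (at s within {a..b})"
    and v: "\<And>s. s \<in> {a..b} \<Longrightarrow> (v has_real_derivative - q s * u s) (at s within {a..b})"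
    and u0: "\<And>s. s \<in> {a..b} \<Longrightarrow> u s \<noteq> 0"
    and ends: "u a * v a < 0" "u b * v b > 0"
    and \<tau>: "\<And>s. s \<in> {a..b} \<Longrightarrow> (\<tau> has_real_derivative r s) (at s within {a..b})"
    and cr: "continuous_on {a..b} r" and cq: "continuous_on {a..b} q"
    and nz: "\<exists>s\<in>{a..b}. \<tau> s \<noteq> 0"
  shows "integral {a..b} (\<lambda>s. (r s)\<^sup>2 - q s * (\<tau> s)\<^sup>2) > 0"
proof -
  define \<rho> where "\<rho> s = v s / u s" for s
  note cu = has_deriv_continuous_on[OF u] and cv = has_deriv_continuous_on[OF v]
    and c\<tau> = has_deriv_continuous_on[OF \<tau>]
  have c\<rho>: "continuous_on {a..b} \<rho>"
    unfolding \<rho>_def using u0 by (intro continuous_intros cu cv) auto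
  have \<rho>a: "\<rho> a < 0" and \<rho>b: "\<rho> b > 0"
    using ends by (auto simp: \<rho>_def divide_simps mult_less_0_iff zero_less_mult_iff)
  have \<rho>: "(\<rho> has_real_derivative - q s - (\<rho> s)\<^sup>2) (at s within {a..b})" if "s \<in> {a..b}" for s
    unfolding \<rho>_def
    by (rule derivative_eq_intros u[OF that] v[OF that] u0[OF that] refl)+
       (use u0[OF that] in \<open>simp add: field_simps power2_eq_square\<close>)
  have "((\<lambda>s. \<rho> s * (\<tau> s)\<^sup>2) has_real_derivative
      ((r s)\<^sup>2 - q s * (\<tau> s)\<^sup>2) - (r s - \<rho> s * \<tau> s)\<^sup>2) (at s within {a..b})"
    if "s \<in> {a..b}" for s
    by (rule derivative_eq_intros \<rho>[OF that] \<tau>[OF that] refl)+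
       (simp add: algebra_simps power2_eq_square)
  then have "((\<lambda>s. ((r s)\<^sup>2 - q s * (\<tau> s)\<^sup>2) - (r s - \<rho> s * \<tau> s)\<^sup>2) has_integral
      \<rho> b * (\<tau> b)\<^sup>2 - \<rho> a * (\<tau> a)\<^sup>2) {a..b}"
    using assms(1) by (intro fundamental_theorem_of_calculus)
      (auto simp: has_real_derivative_iff_has_vector_derivative[symmetric])
  then have "integral {a..b} (\<lambda>s. ((r s)\<^sup>2 - q s * (\<tau> s)\<^sup>2) - (r s - \<rho> s * \<tau> s)\<^sup>2)
      = \<rho> b * (\<tau> b)\<^sup>2 - \<rho> a * (\<tau> a)\<^sup>2"
    by (rule integral_unique)
  moreover have "integral {a..b} (\<lambda>s. ((r s)\<^sup>2 - q s * (\<tau> s)\<^sup>2) - (r s - \<rho> s * \<tau> s)\<^sup>2)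
      = integral {a..b} (\<lambda>s. (r s)\<^sup>2 - q s * (\<tau> s)\<^sup>2) - integral {a..b} (\<lambda>s. (r s - \<rho> s * \<tau> s)\<^sup>2)"
    by (intro integral_diff integrable_continuous_real continuous_intros cr cq c\<tau> c\<rho>)
  ultimately have eq: "integral {a..b} (\<lambda>s. (r s)\<^sup>2 - q s * (\<tau> s)\<^sup>2)
      = \<rho> b * (\<tau> b)\<^sup>2 - \<rho> a * (\<tau> a)\<^sup>2 + integral {a..b} (\<lambda>s. (r s - \<rho> s * \<tau> s)\<^sup>2)"
    by linarith
  have csq: "continuous_on {a..b} (\<lambda>s. (r s - \<rho> s * \<tau> s)\<^sup>2)"
    by (intro continuous_intros cr c\<tau> c\<rho>)
  have I: "integral {a..b} (\<lambda>s. (r s - \<rho> s * \<tau> s)\<^sup>2) \<ge> 0"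
    by (rule integral_nonneg) (auto intro!: integrable_continuous_real csq)
  have B: "\<rho> b * (\<tau> b)\<^sup>2 \<ge> 0" using \<rho>b by simp
  show ?thesis
  proof (cases "\<tau> a = 0")
    case False
    then have "\<rho> a * (\<tau> a)\<^sup>2 < 0" using \<rho>a by (simp add: mult_neg_pos)
    then show ?thesis using eq I B by linarith
  next
    case True
    have "integral {a..b} (\<lambda>s. (r s - \<rho> s * \<tau> s)\<^sup>2) \<noteq> 0"
    proof
      \<comment> \<open>Otherwise \<open>\<tau>\<close> solves the first-order equation satisfied by \<open>u\<close> and vanishes at \<open>a\<close>.\<close>
      assume "integral {a..b} (\<lambda>s. (r s - \<rho> s * \<tau> s)\<^sup>2) = 0"
      then have "\<forall>s\<in>{a..b}. (r s - \<rho> s * \<tau> s)\<^sup>2 = 0"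
        by (subst (asm) integral_eq_0_iff) (use assms(1) csq in auto)
      then have rr: "r s = \<rho> s * \<tau> s" if "s \<in> {a..b}" for s using that by simp
      have "((\<lambda>s. \<tau> s / u s) has_real_derivative 0) (at s within {a..b})" if "s \<in> {a..b}" for s
        by (rule derivative_eq_intros u[OF that] \<tau>[OF that] u0[OF that] refl)+
           (use u0[OF that] in \<open>simp add: rr[OF that] \<rho>_def\<close>)
      then obtain c where c: "\<And>s. s \<in> {a..b} \<Longrightarrow> \<tau> s / u s = c"
        using has_field_derivative_zero_constant[of "{a..b}" "\<lambda>s. \<tau> s / u s"] by auto
      have "c = 0" using c[of a] True assms(1) by simp
      then show False using c nz u0 by fastforce
    qed
    then show ?thesis using eq I B True by simp
  qed
qed

section \<open>Smoothing of truncated test functions\<close>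

lemma max0_square_deriv: "((\<lambda>x::real. (max 0 x)\<^sup>2) has_real_derivative 2 * max 0 x) (at x)"
proof -
  consider "x < 0" | "x > 0" | "x = 0" by linarith
  then show ?thesis
  proof cases
    case 1
    have "((\<lambda>x::real. 0) has_real_derivative 0) (at x)" by simp
    then have "((\<lambda>x::real. (max 0 x)\<^sup>2) has_real_derivative 0) (at x)"
      by (rule has_field_derivative_transform_within_open[where S = "{..<0}"]) (use 1 in auto)
    then show ?thesis using 1 by simp
  next
    case 2
    have "((\<lambda>x::real. x\<^sup>2) has_real_derivative 2 * x) (at x)"
      by (auto intro!: derivative_eq_intros)
    then have "((\<lambda>x::real. (max 0 x)\<^sup>2) has_real_derivative 2 * x) (at x)"
      by (rule has_field_derivative_transform_within_open[where S = "{0<..}"]) (use 2 in auto)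
    then show ?thesis using 2 by simp
  next
    case 3
    have "(\<lambda>h::real. (max 0 h)\<^sup>2 / h) \<midarrow>0\<rightarrow> 0"
    proof (rule Lim_null_comparison)
      show "\<forall>\<^sub>F h in at (0::real). norm ((max 0 h)\<^sup>2 / h) \<le> \<bar>h\<bar>"
        by (rule always_eventually) (auto simp: max_def power2_eq_square)
      show "(\<lambda>h::real. \<bar>h\<bar>) \<midarrow>0\<rightarrow> 0" by (rule tendsto_eq_intros | simp)+
    qed
    then show ?thesis using 3 by (simp add: DERIV_def)
  qed
qed

text \<open>
  The cutoffs are \<open>n m / (1 + n m)\<close> for a \<open>C\<^sup>1\<close> function \<open>m\<close> that is positive exactly on the open
  interval from \<open>c\<close> to \<open>d\<close>.
\<close>

lemma C1_cutoffs:
  fixes c d :: real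
  obtains \<phi> \<phi>' :: "nat \<Rightarrow> real \<Rightarrow> real"
  where "\<And>n s. (\<phi> n has_real_derivative \<phi>' n s) (at s)"
    and "\<And>n. continuous_on UNIV (\<phi>' n)"
    and "\<And>n s. \<bar>\<phi> n s\<bar> \<le> 1"
    and "\<And>n s. \<not> (c < s \<and> s < d) \<Longrightarrow> \<phi> n s = 0"
    and "\<And>s. c < s \<Longrightarrow> s < d \<Longrightarrow> (\<lambda>n. \<phi> n s) \<longlonglongrightarrow> 1"
proof -
  define m where "m s = (max 0 (s - c))\<^sup>2 * (max 0 (d - s))\<^sup>2" for s
  define m' where "m' s = 2 * max 0 (s - c) * (max 0 (d - s))\<^sup>2
      - (max 0 (s - c))\<^sup>2 * (2 * max 0 (d - s))" for s
  define \<phi> where "\<phi> n s = real n * m s / (1 + real n * m s)" for n s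
  define \<phi>' where "\<phi>' n s = real n * m' s / (1 + real n * m s)\<^sup>2" for n s
  have m0: "m s \<ge> 0" for s by (simp add: m_def)
  have pos: "1 + real n * m s > 0" for n s
    using mult_nonneg_nonneg[OF of_nat_0_le_iff[of n] m0[of s]] by linarith
  have m: "(m has_real_derivative m' s) (at s)" for s
    unfolding m_def
    by (rule derivative_eq_intros DERIV_chain2[OF max0_square_deriv] refl)+
       (simp add: m'_def algebra_simps)
  have cm: "continuous_on UNIV m" unfolding m_def by (intro continuous_intros)
  show ?thesis
  proof
    show "(\<phi> n has_real_derivative \<phi>' n s) (at s)" for n s
      unfolding \<phi>_def
      by (rule derivative_eq_intros m refl)+
         (use pos[of n s] in \<open>auto simp: \<phi>'_def field_simps power2_eq_square\<close>)
    show "continuous_on UNIV (\<phi>' n)" for n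
      unfolding \<phi>'_def m'_def by (intro continuous_intros cm) (metis pos less_irrefl power_not_zero)
    show "\<bar>\<phi> n s\<bar> \<le> 1" for n s
      using pos[of n s] m0[of s] by (simp add: \<phi>_def)
    show "\<phi> n s = 0" if "\<not> (c < s \<and> s < d)" for n s
      using that by (auto simp: \<phi>_def m_def)
    show "(\<lambda>n. \<phi> n s) \<longlonglongrightarrow> 1" if "c < s" "s < d" for s
    proof -
      have "m s > 0" using that by (simp add: m_def)
      then have "filterlim (\<lambda>n. 1 + real n * m s) at_top sequentially"
        by (intro filterlim_tendsto_add_at_top[OF tendsto_const]
            filterlim_at_top_mult_tendsto_pos[OF tendsto_const] filterlim_real_sequentially)
      then have "(\<lambda>n. 1 - 1 / (1 + real n * m s)) \<longlonglongrightarrow> 1 - 0"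
        by (intro tendsto_intros tendsto_divide_0[OF tendsto_const] filterlim_at_top_imp_at_infinity)
      moreover have "1 - 1 / (1 + real n * m s) = \<phi> n s" for n
        using pos[of n s] by (simp add: \<phi>_def field_simps)
      ultimately show ?thesis by simp
    qed
  qed
qed

lemma continuous_on_Icc_bounded:
  fixes f :: "real \<Rightarrow> real"
  assumes "continuous_on {a..b} f"
  shows "\<exists>B. \<forall>s\<in>{a..b}. \<bar>f s\<bar> \<le> B"
  using compact_imp_bounded[OF compact_continuous_image[OF assms compact_Icc]]
  unfolding bounded_iff by auto

lemma jacobi_form_limit:
  fixes f :: "nat \<Rightarrow> real \<Rightarrow> real"
  assumes "a < b" and cq: "continuous_on {a..b} q"
    and cf: "\<And>n. continuous_on {a..b} (f n)"
    and bound: "\<And>n s. s \<in> {a..b} \<Longrightarrow> \<bar>f n s\<bar> \<le> C"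
    and lim: "\<And>s. s \<in> {a..b} \<Longrightarrow> (\<lambda>n. f n s) \<longlonglongrightarrow> g s"
    and g: "\<And>s. s \<in> {a..b} \<Longrightarrow> (g has_integral \<tau> s - k) {a..s}"
  shows "(\<lambda>n. integral {a..b} (\<lambda>s. (f n s)\<^sup>2 - q s * (k + integral {a..s} (f n))\<^sup>2))
    \<longlonglongrightarrow> integral {a..b} (\<lambda>s. (g s)\<^sup>2 - q s * (\<tau> s)\<^sup>2)"
proof -
  obtain B where B: "\<And>s. s \<in> {a..b} \<Longrightarrow> \<bar>q s\<bar> \<le> B"
    using continuous_on_Icc_bounded[OF cq] by blast
  have cI: "continuous_on {a..b} (\<lambda>s. integral {a..s} (f n))" for n
    by (rule indefinite_integral_continuous_1[OF integrable_continuous_real[OF cf]])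
  have C0: "C \<ge> 0" using bound[of a 0] assms(1) by simp
  have B0: "B \<ge> 0" using B[of a] assms(1) by fastforce
  have bI: "\<bar>k + integral {a..s} (f n)\<bar> \<le> \<bar>k\<bar> + C * (b - a)" if s: "s \<in> {a..b}" for n s
  proof -
    have "norm (integral {a..s} (f n)) \<le> C * (s - a)"
      using s bound by (intro integral_bound continuous_on_subset[OF cf]) auto
    also have "\<dots> \<le> C * (b - a)" using s C0 by (intro mult_left_mono) auto
    finally show ?thesis unfolding real_norm_def by linarith
  qed
  have sub: "f n integrable_on {a..s}" if "s \<in> {a..b}" for n s
    using that by (intro integrable_continuous_real continuous_on_subset[OF cf]) auto
  have limI: "(\<lambda>n. k + integral {a..s} (f n)) \<longlonglongrightarrow> \<tau> s" if s: "s \<in> {a..b}" for s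
  proof -
    have "(\<lambda>n. integral {a..s} (f n)) \<longlonglongrightarrow> integral {a..s} g"
      using s bound lim sub[OF s]
      by (intro dominated_convergence(2)[where h = "\<lambda>_. C"]) auto
    also have "integral {a..s} g = \<tau> s - k" using g[OF s] by (rule integral_unique)
    finally show ?thesis using tendsto_add[OF tendsto_const[of k]] by fastforce
  qed
  show ?thesis
  proof (rule dominated_convergence(2)[where h = "\<lambda>_. C\<^sup>2 + B * (\<bar>k\<bar> + C * (b - a))\<^sup>2"])
    show "(\<lambda>s. (f n s)\<^sup>2 - q s * (k + integral {a..s} (f n))\<^sup>2) integrable_on {a..b}" for n
      by (intro integrable_continuous_real continuous_intros cf cq cI)
    fix n s assume s: "s \<in> {a..b}"
    have "(f n s)\<^sup>2 \<le> C\<^sup>2"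
      using bound[OF s, of n] C0 by (simp add: abs_le_square_iff[symmetric])
    moreover have "(k + integral {a..s} (f n))\<^sup>2 \<le> (\<bar>k\<bar> + C * (b - a))\<^sup>2"
      using power_mono[OF bI[OF s, of n], of 2] by simp
    then have "\<bar>q s\<bar> * (k + integral {a..s} (f n))\<^sup>2 \<le> B * (\<bar>k\<bar> + C * (b - a))\<^sup>2"
      using B[OF s] B0 by (intro mult_mono) auto
    then have "\<bar>q s * (k + integral {a..s} (f n))\<^sup>2\<bar> \<le> B * (\<bar>k\<bar> + C * (b - a))\<^sup>2"
      by (simp add: abs_mult)
    ultimately show "norm ((f n s)\<^sup>2 - q s * (k + integral {a..s} (f n))\<^sup>2)
        \<le> C\<^sup>2 + B * (\<bar>k\<bar> + C * (b - a))\<^sup>2"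
      unfolding real_norm_def using zero_le_power2[of "f n s"] by linarith
  next
    fix s assume s: "s \<in> {a..b}"
    show "(\<lambda>n. (f n s)\<^sup>2 - q s * (k + integral {a..s} (f n))\<^sup>2) \<longlonglongrightarrow> (g s)\<^sup>2 - q s * (\<tau> s)\<^sup>2"
      by (intro tendsto_intros lim[OF s] limI[OF s])
  qed auto
qed

text \<open>
  The test function here is \<open>u (max c (min d s)) + \<delta> (s - c)\<close>, where \<open>u\<close> is continued by its values at
  \<open>c\<close> and \<open>d\<close>. Its derivative is truncated on \<open>[c,d]\<close> (the part from \<open>u\<close>) and on \<open>[a,b]\<close> (the part
  from \<open>\<delta>\<close>), so that the integrand is the pointwise limit of the smooth ones at every point.
\<close>

lemma truncated_negative_imp_DN_negative:
  fixes \<delta> :: real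
  assumes "a < b" "a \<le> c" "c < d" "d \<le> b" and cq: "continuous_on {a..b} q"
    and u: "\<And>s. s \<in> {a..b} \<Longrightarrow> (u has_real_derivative v s) (at s within {a..b})"
    and v: "\<And>s. s \<in> {a..b} \<Longrightarrow> (v has_real_derivative w s) (at s within {a..b})"
    and cw: "continuous_on {a..b} w"
    and neg: "integral {a..b} (\<lambda>s. ((if c < s \<and> s < d then v s else 0) + (if a < s \<and> s < b then \<delta> else 0))\<^sup>2
      - q s * (u (max c (min d s)) + \<delta> * (s - c))\<^sup>2) < 0"
  shows "\<exists>\<tau>\<in>DN a b. integral {a..b} (\<lambda>s. (deriv_on a b \<tau> s)\<^sup>2 - q s * (\<tau> s)\<^sup>2) < 0"
proof -
  obtain \<phi> \<phi>' :: "nat \<Rightarrow> real \<Rightarrow> real" where \<phi>: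
    "\<And>n s. (\<phi> n has_real_derivative \<phi>' n s) (at s)" "\<And>n. continuous_on UNIV (\<phi>' n)"
    "\<And>n s. \<bar>\<phi> n s\<bar> \<le> 1" "\<And>n s. \<not> (c < s \<and> s < d) \<Longrightarrow> \<phi> n s = 0"
    "\<And>s. c < s \<Longrightarrow> s < d \<Longrightarrow> (\<lambda>n. \<phi> n s) \<longlonglongrightarrow> 1"
    by (rule C1_cutoffs[of c d], rule that)
  obtain \<eta> \<eta>' :: "nat \<Rightarrow> real \<Rightarrow> real" where \<eta>:
    "\<And>n s. (\<eta> n has_real_derivative \<eta>' n s) (at s)" "\<And>n. continuous_on UNIV (\<eta>' n)"
    "\<And>n s. \<bar>\<eta> n s\<bar> \<le> 1" "\<And>n s. \<not> (a < s \<and> s < b) \<Longrightarrow> \<eta> n s = 0"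
    "\<And>s. a < s \<Longrightarrow> s < b \<Longrightarrow> (\<lambda>n. \<eta> n s) \<longlonglongrightarrow> 1"
    by (rule C1_cutoffs[of a b], rule that)
  note cu = has_deriv_continuous_on[OF u] and cv = has_deriv_continuous_on[OF v]
  define \<sigma> where "\<sigma> s = u (max c (min d s)) + \<delta> * (s - c)" for s
  define g where "g s = (if c < s \<and> s < d then v s else 0) + (if a < s \<and> s < b then \<delta> else 0)" for s
  define f where "f n s = v s * \<phi> n s + \<delta> * \<eta> n s" for n s
  define f' where "f' n s = w s * \<phi> n s + v s * \<phi>' n s + \<delta> * \<eta>' n s" for n s
  have c\<sigma>: "continuous_on {a..b} \<sigma>"
    unfolding \<sigma>_def
    by (intro continuous_intros continuous_on_compose2[OF cu]) (use assms in auto)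
  \<comment> \<open>\<open>g\<close> is the derivative of \<open>\<sigma>\<close> except at \<open>c\<close>, \<open>d\<close> and the end points.\<close>
  have g: "(g has_integral \<sigma> s - \<sigma> a) {a..s}" if s: "s \<in> {a..b}" for s
  proof (rule fundamental_theorem_of_calculus_interior_strong[where S = "{c, d}"])
    show "continuous_on {a..s} \<sigma>" using s by (intro continuous_on_subset[OF c\<sigma>]) auto
    fix x assume x: "x \<in> {a<..<s} - {c, d}"
    have lin: "((\<lambda>s. C + \<delta> * (s - c)) has_real_derivative \<delta>) (at x)" for C
      by (auto intro!: derivative_eq_intros)
    consider "x < c" | "d < x" | "c < x" "x < d" using x assms by force
    then have "(\<sigma> has_real_derivative g x) (at x)"
    proof cases
      case 1
      then have "g x = \<delta>" using x s assms by (auto simp: g_def)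
      show ?thesis unfolding \<open>g x = \<delta>\<close>
        by (rule has_field_derivative_transform_within_open[OF lin[of "u c"], where S = "{..<c}"])
           (use 1 assms in \<open>auto simp: \<sigma>_def\<close>)
    next
      case 2
      then have "g x = \<delta>" using x s assms by (auto simp: g_def)
      show ?thesis unfolding \<open>g x = \<delta>\<close>
        by (rule has_field_derivative_transform_within_open[OF lin[of "u d"], where S = "{d<..}"])
           (use 2 assms in \<open>auto simp: \<sigma>_def\<close>)
    next
      case 3
      have "(u has_real_derivative v x) (at x)"
        using u[of x] x s by (simp add: at_within_Icc_at)
      then have "((\<lambda>s. u s + \<delta> * (s - c)) has_real_derivative g x) (at x)"
        using x s 3 by (auto simp: g_def intro!: derivative_eq_intros)
      then show ?thesis
        by (rule has_field_derivative_transform_within_open[where S = "{c<..<d}"])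
           (use 3 in \<open>auto simp: \<sigma>_def\<close>)
    qed
    then show "(\<sigma> has_vector_derivative g x) (at x)"
      by (simp add: has_real_derivative_iff_has_vector_derivative)
  qed (use s in auto)
  have f: "(f n has_real_derivative f' n s) (at s within {a..b})" if "s \<in> {a..b}" for n s
    unfolding f_def
    by (rule derivative_eq_intros v[OF that] has_field_derivative_at_within[OF \<phi>(1)]
        has_field_derivative_at_within[OF \<eta>(1)] refl)+ (simp add: f'_def algebra_simps)
  have cf: "continuous_on {a..b} (f n)" for n by (rule has_deriv_continuous_on[OF f])
  have c\<phi>: "continuous_on {a..b} (\<phi> n)" for n
    by (rule has_deriv_continuous_on[OF has_field_derivative_at_within[OF \<phi>(1)]])
  have cf': "continuous_on {a..b} (f' n)" for n
    unfolding f'_def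
    by (intro continuous_intros cw cv c\<phi> continuous_on_subset[OF \<phi>(2)] continuous_on_subset[OF \<eta>(2)]) auto
  obtain B where B: "\<And>s. s \<in> {a..b} \<Longrightarrow> \<bar>v s\<bar> \<le> B"
    using continuous_on_Icc_bounded[OF cv] by blast
  have "(\<lambda>n. integral {a..b} (\<lambda>s. (f n s)\<^sup>2 - q s * (\<sigma> a + integral {a..s} (f n))\<^sup>2))
      \<longlonglongrightarrow> integral {a..b} (\<lambda>s. (g s)\<^sup>2 - q s * (\<sigma> s)\<^sup>2)"
  proof (rule jacobi_form_limit[OF assms(1) cq cf _ _ g])
    fix n s assume s: "s \<in> {a..b}"
    have "\<bar>f n s\<bar> \<le> \<bar>v s\<bar> * \<bar>\<phi> n s\<bar> + \<bar>\<delta>\<bar> * \<bar>\<eta> n s\<bar>"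
      unfolding f_def by (metis abs_triangle_ineq abs_mult)
    also have "\<dots> \<le> B * 1 + \<bar>\<delta>\<bar> * 1"
      using B[OF s] \<phi>(3) \<eta>(3) by (intro add_mono mult_mono) auto
    finally show "\<bar>f n s\<bar> \<le> B + \<bar>\<delta>\<bar>" by simp
  next
    fix s assume s: "s \<in> {a..b}"
    have 1: "(\<lambda>n. \<phi> n s) \<longlonglongrightarrow> (if c < s \<and> s < d then 1 else 0)"
      using \<phi>(4,5) by auto
    have 2: "(\<lambda>n. \<eta> n s) \<longlonglongrightarrow> (if a < s \<and> s < b then 1 else 0)"
      using \<eta>(4,5) by auto
    have "g s = v s * (if c < s \<and> s < d then 1 else 0) + \<delta> * (if a < s \<and> s < b then 1 else 0)"
      by (simp add: g_def)
    then show "(\<lambda>n. f n s) \<longlonglongrightarrow> g s"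
      unfolding f_def by (simp only:) (intro tendsto_intros 1 2)
  qed
  moreover have "integral {a..b} (\<lambda>s. (g s)\<^sup>2 - q s * (\<sigma> s)\<^sup>2) < 0"
    using neg by (simp only: g_def \<sigma>_def)
  ultimately have "\<forall>\<^sub>F n in sequentially.
      integral {a..b} (\<lambda>s. (f n s)\<^sup>2 - q s * (\<sigma> a + integral {a..s} (f n))\<^sup>2) < 0"
    by (rule order_tendstoD(2))
  then obtain n where n: "integral {a..b} (\<lambda>s. (f n s)\<^sup>2 - q s * (\<sigma> a + integral {a..s} (f n))\<^sup>2) < 0"
    by (meson eventually_happens sequentially_bot)
  define \<tau> where "\<tau> s = \<sigma> a + integral {a..s} (f n)" for s
  have \<tau>: "(\<tau> has_real_derivative f n s) (at s within {a..b})" if "s \<in> {a..b}" for s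
    unfolding \<tau>_def using integral_has_real_derivative[OF cf that]
    by (auto intro!: derivative_eq_intros)
  have d\<tau>: "deriv_on a b \<tau> s = f n s" if "s \<in> {a..b}" for s
    by (rule deriv_on_eq[OF assms(1) that \<tau>[OF that]])
  have "integral {a..b} (\<lambda>s. (deriv_on a b \<tau> s)\<^sup>2 - q s * (\<tau> s)\<^sup>2)
      = integral {a..b} (\<lambda>s. (f n s)\<^sup>2 - q s * (\<sigma> a + integral {a..s} (f n))\<^sup>2)"
    by (rule integral_cong) (simp only: d\<tau> \<tau>_def)
  then have Q: "integral {a..b} (\<lambda>s. (deriv_on a b \<tau> s)\<^sup>2 - q s * (\<tau> s)\<^sup>2) < 0"
    using n by simp
  have "\<exists>s\<in>{a..b}. \<tau> s \<noteq> 0"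
  proof (rule ccontr)
    assume 0: "\<not> (\<exists>s\<in>{a..b}. \<tau> s \<noteq> 0)"
    then have "integral {a..b} (\<lambda>s. (deriv_on a b \<tau> s)\<^sup>2 - q s * (\<tau> s)\<^sup>2) = integral {a..b} (\<lambda>s. 0)"
      using deriv_on_zero[OF assms(1)] by (intro integral_cong) auto
    then show False using Q by simp
  qed
  moreover have "\<tau> \<in> C2_on a b"
    by (rule C2_onI[OF assms(1) \<tau> f cf'])
  moreover have "deriv_on a b \<tau> a = 0" "deriv_on a b \<tau> b = 0"
    using d\<tau>[of a] d\<tau>[of b] \<phi>(4) \<eta>(4) assms(1-4) by (auto simp: f_def)
  ultimately have "\<tau> \<in> DN a b" by (simp add: DN_def)
  then show ?thesis using Q by blast
qed

section \<open>Negative directions\<close>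

text \<open>The value of the quadratic form at \<open>u\<close> is \<open>u b u' b - u a u' a\<close>.\<close>

lemma boundary_negative_direction:
  assumes "a < b" and cq: "continuous_on {a..b} q"
    and u: "\<And>s. s \<in> {a..b} \<Longrightarrow> (u has_real_derivative v s) (at s within {a..b})"
    and v: "\<And>s. s \<in> {a..b} \<Longrightarrow> (v has_real_derivative - q s * u s) (at s within {a..b})"
    and less: "u b * v b < u a * v a"
  shows "\<exists>\<tau>\<in>DN a b. integral {a..b} (\<lambda>s. (deriv_on a b \<tau> s)\<^sup>2 - q s * (\<tau> s)\<^sup>2) < 0"
proof (rule truncated_negative_imp_DN_negative[where c = a and d = b and \<delta> = 0, OF assms(1) _ _ _ cq u v])
  show "continuous_on {a..b} (\<lambda>s. - q s * u s)"
    by (intro continuous_intros cq has_deriv_continuous_on[OF u])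
  have "((\<lambda>s. u s * v s) has_real_derivative (v s)\<^sup>2 - q s * (u s)\<^sup>2) (at s within {a..b})"
    if "s \<in> {a..b}" for s
    by (rule derivative_eq_intros u[OF that] v[OF that] refl)+ (simp add: power2_eq_square)
  then have "((\<lambda>s. (v s)\<^sup>2 - q s * (u s)\<^sup>2) has_integral u b * v b - u a * v a) {a..b}"
    using assms(1) by (intro fundamental_theorem_of_calculus)
      (auto simp: has_real_derivative_iff_has_vector_derivative[symmetric])
  then have "((\<lambda>s. ((if a < s \<and> s < b then v s else 0) + (if a < s \<and> s < b then 0 else 0))\<^sup>2
      - q s * (u (max a (min b s)) + 0 * (s - a))\<^sup>2) has_integral u b * v b - u a * v a) {a..b}"
    by (rule has_integral_spike_finite[where S = "{a, b}", rotated 2]) auto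
  from integral_unique[OF this] less show "integral {a..b} (\<lambda>s. ((if a < s \<and> s < b then v s else 0) + (if a < s \<and> s < b then 0 else 0))\<^sup>2
      - q s * (u (max a (min b s)) + 0 * (s - a))\<^sup>2) < 0"
    by (simp only: diff_less_0_iff_less)
qed (use assms(1) in auto)

text \<open>
  The quadratic form vanishes at \<open>u\<close> truncated to \<open>[c,d]\<close>. The polarised form of this function with
  \<open>s - c\<close> is \<open>[(s - c) u' s]\<close> taken from \<open>c\<close> to \<open>d\<close>, that is \<open>(d - c) u' d\<close>, which is nonzero; hence
  a small multiple of \<open>s - c\<close> of the right sign makes the form negative.
\<close>

lemma conjugate_points_negative_direction:
  assumes "a \<le> c" "c < d" "d \<le> b" and cq: "continuous_on {a..b} q"
    and u: "\<And>s. s \<in> {a..b} \<Longrightarrow> (u has_real_derivative v s) (at s within {a..b})"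
    and v: "\<And>s. s \<in> {a..b} \<Longrightarrow> (v has_real_derivative - q s * u s) (at s within {a..b})"
    and zeros: "u c = 0" "u d = 0" and vd: "v d \<noteq> 0"
  shows "\<exists>\<tau>\<in>DN a b. integral {a..b} (\<lambda>s. (deriv_on a b \<tau> s)\<^sup>2 - q s * (\<tau> s)\<^sup>2) < 0"
proof -
  have ab: "a < b" using assms by linarith
  define K where "K = integral {a..b} (\<lambda>s. 1 - q s * (s - c)\<^sup>2)"
  define L where "L = (d - c) * v d"
  \<comment> \<open>Half the linear coefficient is \<open>L\<close> and the quadratic one is \<open>K\<close> in the expansion in \<open>\<delta>\<close>.\<close>
  define \<delta> where "\<delta> = - L / (1 + \<bar>K\<bar>)"
  have L: "L \<noteq> 0" using vd assms(2) by (simp add: L_def)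
  have val: "2 * \<delta> * L + \<delta>\<^sup>2 * K < 0"
  proof -
    have p: "1 + \<bar>K\<bar> > 0" by linarith
    have "2 * (- L / N) * L + (- L / N)\<^sup>2 * K = (L / N)\<^sup>2 * (K - 2 * N)" if "N > 0" for N
      using that by (simp add: field_simps power2_eq_square)
    from this[OF p] have "2 * \<delta> * L + \<delta>\<^sup>2 * K = (L / (1 + \<bar>K\<bar>))\<^sup>2 * (K - 2 * (1 + \<bar>K\<bar>))"
      by (simp only: \<delta>_def)
    also have "\<dots> < 0" using L p by (intro mult_pos_neg) auto
    finally show ?thesis .
  qed
  have "((\<lambda>s. u s * v s + 2 * \<delta> * ((s - c) * v s)) has_real_derivative
      (v s)\<^sup>2 - q s * (u s)\<^sup>2 + 2 * \<delta> * (v s - q s * u s * (s - c))) (at s within {c..d})"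
    if s: "s \<in> {c..d}" for s
  proof -
    have s': "s \<in> {a..b}" using s assms by auto
    have sub: "{c..d} \<subseteq> {a..b}" using assms by auto
    show ?thesis
      by (rule derivative_eq_intros DERIV_subset[OF u[OF s'] sub] DERIV_subset[OF v[OF s'] sub] refl)+
         (simp add: power2_eq_square algebra_simps)
  qed
  then have "((\<lambda>s. (v s)\<^sup>2 - q s * (u s)\<^sup>2 + 2 * \<delta> * (v s - q s * u s * (s - c))) has_integral
      (u d * v d + 2 * \<delta> * ((d - c) * v d)) - (u c * v c + 2 * \<delta> * ((c - c) * v c))) {c..d}"
    using assms(2) by (intro fundamental_theorem_of_calculus)
      (auto simp: has_real_derivative_iff_has_vector_derivative[symmetric])
  then have "((\<lambda>s. (v s)\<^sup>2 - q s * (u s)\<^sup>2 + 2 * \<delta> * (v s - q s * u s * (s - c))) has_integral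
      2 * \<delta> * L) {c..d}"
    by (simp add: zeros L_def)
  then have 1: "((\<lambda>s. if s \<in> {c..d} then (v s)\<^sup>2 - q s * (u s)\<^sup>2 + 2 * \<delta> * (v s - q s * u s * (s - c)) else 0)
      has_integral 2 * \<delta> * L) {a..b}"
    by (subst has_integral_restrict) (use assms in auto)
  have "((\<lambda>s. 1 - q s * (s - c)\<^sup>2) has_integral K) {a..b}"
    unfolding K_def
    by (intro integrable_integral integrable_continuous_real continuous_intros cq)
  from has_integral_add[OF 1 has_integral_mult_right[OF this, of "\<delta>\<^sup>2"]]
  have 2: "((\<lambda>s. (if s \<in> {c..d} then (v s)\<^sup>2 - q s * (u s)\<^sup>2 + 2 * \<delta> * (v s - q s * u s * (s - c)) else 0)
      + \<delta>\<^sup>2 * (1 - q s * (s - c)\<^sup>2)) has_integral 2 * \<delta> * L + \<delta>\<^sup>2 * K) {a..b}" .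
  have "((\<lambda>s. ((if c < s \<and> s < d then v s else 0) + (if a < s \<and> s < b then \<delta> else 0))\<^sup>2
      - q s * (u (max c (min d s)) + \<delta> * (s - c))\<^sup>2) has_integral 2 * \<delta> * L + \<delta>\<^sup>2 * K) {a..b}"
  proof (rule has_integral_spike_finite[OF _ _ 2])
    fix s assume s: "s \<in> {a..b} - {a, b, c, d}"
    consider "s < c" | "d < s" | "c < s" "s < d" using s by force
    then show "((if c < s \<and> s < d then v s else 0) + (if a < s \<and> s < b then \<delta> else 0))\<^sup>2
        - q s * (u (max c (min d s)) + \<delta> * (s - c))\<^sup>2
      = (if s \<in> {c..d} then (v s)\<^sup>2 - q s * (u s)\<^sup>2 + 2 * \<delta> * (v s - q s * u s * (s - c)) else 0)
        + \<delta>\<^sup>2 * (1 - q s * (s - c)\<^sup>2)"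
      by cases (use s assms(1-3) zeros in \<open>auto simp: algebra_simps power2_eq_square\<close>)
  qed auto
  from integral_unique[OF this] val have "integral {a..b} (\<lambda>s. ((if c < s \<and> s < d then v s else 0) + (if a < s \<and> s < b then \<delta> else 0))\<^sup>2
      - q s * (u (max c (min d s)) + \<delta> * (s - c))\<^sup>2) < 0"
    by (simp only:)
  moreover have "continuous_on {a..b} (\<lambda>s. - q s * u s)"
    by (intro continuous_intros cq has_deriv_continuous_on[OF u])
  ultimately show ?thesis
    using truncated_negative_imp_DN_negative[OF ab assms(1-4) u v] by blast
qed

section \<open>The index\<close>

text \<open>
  The function \<open>u\<close> is \<open>\<theta>'\<close>, and the last sum counts its zeros with the weights of
  \<open>sum_sgn_simple_zeros\<close>. The crossings lie in the interior, since \<open>V'(\<theta>)\<close> does not vanish at the end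
  points, and so each has weight \<open>2\<close>.
\<close>

lemma index_identity:
  fixes a b A :: real and V \<theta> :: "real \<Rightarrow> real"
  assumes "a < b" "C2_real V" and nd: "\<nexists>x. deriv V x = 0 \<and> deriv (deriv V) x = 0"
    and \<theta>: "\<And>s. s \<in> {a..b} \<Longrightarrow> (\<theta> has_real_derivative u s) (at s within {a..b})"
    and u: "\<And>s. s \<in> {a..b} \<Longrightarrow> (u has_real_derivative - deriv V (\<theta> s)) (at s within {a..b})"
    and ends: "deriv V (\<theta> a) \<noteq> 0" "deriv V (\<theta> b) \<noteq> 0"
    and reg: "\<And>s. s \<in> {a..b} \<Longrightarrow> deriv V (\<theta> s) = 0 \<Longrightarrow> u s \<noteq> 0"
  shows "2 * real_of_int (index a b V (phase_traj a b \<theta>))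
    = sgn (u b * deriv V (\<theta> b)) - sgn (u a * deriv V (\<theta> a))
      + (\<Sum>z | z \<in> {a..b} \<and> u z = 0. sgn (b - z) - sgn (a - z))"
proof -
  note V = C2_real_derivs[OF assms(2)]
  define g where "g s = deriv V (\<theta> s)" for s
  define q where "q s = deriv (deriv V) (\<theta> s)" for s
  have g: "(g has_real_derivative q s * u s) (at s within {a..b})" if "s \<in> {a..b}" for s
    unfolding g_def q_def by (rule DERIV_chain2[OF V(2) \<theta>[OF that]])
  define p where "p s = u s * g s" for s
  define p' where "p' s = q s * (u s)\<^sup>2 - (g s)\<^sup>2" for s
  have p: "(p has_real_derivative p' s) (at s within {a..b})" if "s \<in> {a..b}" for s
    unfolding p_def
    by (rule derivative_eq_intros g[OF that] u[OF that, folded g_def] refl)+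
       (simp add: p'_def power2_eq_square algebra_simps)
  \<comment> \<open>The zeros of \<open>p\<close> are the crossings of both kinds and the zeros of \<open>u\<close>.\<close>
  have gq: "q s \<noteq> 0" if "g s = 0" for s
    using nd that by (auto simp: g_def q_def)
  have gu: "u s \<noteq> 0" if "g s = 0" "s \<in> {a..b}" for s
    using reg that by (auto simp: g_def)
  define Zm where "Zm = {s\<in>{a..b}. g s = 0 \<and> q s > 0}"
  define ZM where "ZM = {s\<in>{a..b}. g s = 0 \<and> q s < 0}"
  define Zu where "Zu = {s\<in>{a..b}. u s = 0}"
  have sm: "sgn (p' z) = 1" if "z \<in> Zm" for z
    using that gu by (auto simp: Zm_def p'_def)
  have sM: "sgn (p' z) = -1" if "z \<in> ZM" for z
    using that gu by (auto simp: ZM_def p'_def mult_neg_pos)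
  have su: "sgn (p' z) = -1" if "z \<in> Zu" for z
  proof -
    have "g z \<noteq> 0" using that gu by (auto simp: Zu_def)
    then have "p' z < 0" using that by (simp add: Zu_def p'_def)
    then show ?thesis by simp
  qed
  have Z: "{z \<in> {a..b}. p z = 0} = (Zm \<union> ZM) \<union> Zu"
    using gq by (force simp: p_def Zm_def ZM_def Zu_def)
  have simple: "p' s \<noteq> 0" if "s \<in> {a..b}" "p s = 0" for s
    using that Z sm sM su by fastforce
  have "finite {z \<in> {a..b}. p z = 0}" by (rule finite_simple_zeros[OF p simple])
  then have fin: "finite Zm" "finite ZM" "finite Zu" unfolding Z by auto
  have disj: "Zm \<inter> ZM = {}" "(Zm \<union> ZM) \<inter> Zu = {}"
    using gu by (auto simp: Zm_def ZM_def Zu_def)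
  have inner: "sgn (b - z) - sgn (a - z) = 2" if "z \<in> Zm \<union> ZM" for z
  proof -
    have "z \<noteq> a" "z \<noteq> b" using that ends by (auto simp: Zm_def ZM_def g_def)
    then show ?thesis using that by (auto simp: Zm_def ZM_def)
  qed
  have "sgn (p b) - sgn (p a)
      = (\<Sum>z\<in>(Zm \<union> ZM) \<union> Zu. sgn (p' z) * (sgn (b - z) - sgn (a - z)))"
    using sum_sgn_simple_zeros[OF less_imp_le[OF assms(1)] p simple] by (simp only: Z)
  also have "\<dots> = (\<Sum>z\<in>Zm. sgn (p' z) * (sgn (b - z) - sgn (a - z)))
      + (\<Sum>z\<in>ZM. sgn (p' z) * (sgn (b - z) - sgn (a - z)))
      + (\<Sum>z\<in>Zu. sgn (p' z) * (sgn (b - z) - sgn (a - z)))"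
    using fin disj by (simp add: sum.union_disjoint)
  also have "(\<Sum>z\<in>Zm. sgn (p' z) * (sgn (b - z) - sgn (a - z))) = (\<Sum>z\<in>Zm. 2)"
    by (rule sum.cong) (use sm inner in auto)
  also have "(\<Sum>z\<in>ZM. sgn (p' z) * (sgn (b - z) - sgn (a - z))) = (\<Sum>z\<in>ZM. -2)"
    by (rule sum.cong) (use sM inner in auto)
  also have "(\<Sum>z\<in>Zu. sgn (p' z) * (sgn (b - z) - sgn (a - z)))
      = (\<Sum>z\<in>Zu. - (sgn (b - z) - sgn (a - z)))"
    by (rule sum.cong) (use su in auto)
  finally have "sgn (p b) - sgn (p a)
      = 2 * real (card Zm) - 2 * real (card ZM) - (\<Sum>z\<in>Zu. sgn (b - z) - sgn (a - z))"
    by (simp add: sum_negf del: minus_diff_eq)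
  moreover have "index a b V (phase_traj a b \<theta>) = int (card Zm) - int (card ZM)"
    by (simp add: index_def phase_traj_def Gamma_m_def Gamma_M_def Zm_def ZM_def g_def q_def)
  ultimately show ?thesis by (simp add: p_def g_def Zu_def)
qed

theorem theorem3:
  fixes a b A :: real and V \<theta> :: "real \<Rightarrow> real"
  assumes "a < b"
    and "C2_real V"
    and "\<nexists>x. deriv V x = 0 \<and> deriv (deriv V) x = 0"
    and "stationary_free a b A V \<theta>"
    and "deriv V (\<theta> a) \<noteq> 0"
    and "deriv V (\<theta> b) \<noteq> 0"
    and "\<nexists>s. s \<in> {a..b} \<and> deriv_on a b \<theta> s = 0 \<and> deriv V (\<theta> s) = 0"
  shows "(index a b V (phase_traj a b \<theta>) > 0 \<longrightarrow> \<not> locally_minimal a b A V (DN a b) \<theta>)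
       \<and> (index a b V (phase_traj a b \<theta>) < 0 \<longrightarrow> locally_minimal a b A V (DN a b) \<theta>)"
proof -
  note V = C2_real_derivs[OF assms(2)]
  define u where "u = deriv_on a b \<theta>"
  define v where "v = (\<lambda>s. - deriv V (\<theta> s))"
  define q where "q s = deriv (deriv V) (\<theta> s)" for s
  have \<theta>C1: "\<theta> \<in> C1_on a b" using assms(4) by (simp add: stationary_free_def)
  have \<theta>: "(\<theta> has_real_derivative u s) (at s within {a..b})" if "s \<in> {a..b}" for s
    unfolding u_def by (rule C1_on_has_deriv[OF \<theta>C1 that])
  note EL = stationary_free_Euler_Lagrange[OF assms(1,2,4), folded u_def]
  have u: "(u has_real_derivative v s) (at s within {a..b})" if "s \<in> {a..b}" for s
    unfolding v_def by (rule EL(3)[OF that])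
  have v: "(v has_real_derivative - q s * u s) (at s within {a..b})" if "s \<in> {a..b}" for s
    using DERIV_minus[OF DERIV_chain2[OF V(2) \<theta>[OF that]]] by (simp add: v_def q_def)
  have cq: "continuous_on {a..b} q"
    unfolding q_def
    by (rule continuous_on_compose2[OF V(5) has_deriv_continuous_on[OF \<theta>]]) auto
  have reg: "v s \<noteq> 0" if "s \<in> {a..b}" "u s = 0" for s
    using assms(7) that by (auto simp: v_def u_def)
  define Z where "Z = {s\<in>{a..b}. u s = 0}"
  define k where "k z = sgn (b - z) - sgn (a - z)" for z
  have finZ: "finite Z" unfolding Z_def by (rule finite_simple_zeros[OF u reg])
  have k: "k z > 0" if "z \<in> Z" for z
    using that assms(1) by (auto simp: k_def Z_def sgn_if)
  have J: "2 * real_of_int (index a b V (phase_traj a b \<theta>))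
      = sgn (u a * v a) - sgn (u b * v b) + (\<Sum>z\<in>Z. k z)"
    using index_identity[OF assms(1-3) \<theta> EL(3) assms(5,6)] assms(7)
    by (auto simp: Z_def k_def v_def u_def sgn_mult)
  have DN_crit: "\<tau> \<in> C1_on a b"
    "((\<lambda>e. energy a b A V (\<lambda>s. \<theta> s + e * \<tau> s)) has_real_derivative 0) (at 0)"
    if "\<tau> \<in> DN a b" for \<tau>
    using that assms(4) by (auto simp: DN_def C2_on_def CN_def stationary_free_def)
  have part1: "\<not> locally_minimal a b A V (DN a b) \<theta>"
    if J0: "index a b V (phase_traj a b \<theta>) > 0"
  proof -
    have "\<exists>\<tau>\<in>DN a b. integral {a..b} (\<lambda>s. (deriv_on a b \<tau> s)\<^sup>2 - q s * (\<tau> s)\<^sup>2) < 0"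
    proof (cases "Z = {}")
      case True
      have "sgn x - sgn y > 0 \<Longrightarrow> y < x" for x y :: real
        by (auto simp: sgn_if split: if_splits)
      moreover have "sgn (u a * v a) - sgn (u b * v b) > 0" using J J0 True by simp
      ultimately have "u b * v b < u a * v a" by blast
      then show ?thesis using boundary_negative_direction[OF assms(1) cq u v] by blast
    next
      case False
      have "Z \<noteq> {z}" for z
      proof
        \<comment> \<open>The signed count of the zeros of \<open>u\<close> vanishes, because \<open>u a = u b\<close>.\<close>
        assume Zz: "Z = {z}"
        have "(\<Sum>z\<in>Z. sgn (v z) * k z) = sgn (u b) - sgn (u a)"
          using sum_sgn_simple_zeros[OF less_imp_le[OF assms(1)] u reg]
          by (simp only: Z_def k_def)
        then have "sgn (v z) * k z = 0" using EL(1,2) Zz by simp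
        moreover have "z \<in> Z" using Zz by blast
        then have "k z > 0" "v z \<noteq> 0" using k reg by (auto simp: Z_def)
        ultimately show False by (simp add: sgn_eq_0_iff)
      qed
      then obtain x y where "x \<in> Z" "y \<in> Z" "y \<noteq> x" using False by blast
      then obtain c d where "c \<in> Z" "d \<in> Z" "c < d"
        by (cases x y rule: linorder_cases) auto
      then show ?thesis
        using reg by (intro conjugate_points_negative_direction[of a c d b q u v, OF _ _ _ cq u v])
          (auto simp: Z_def)
    qed
    then obtain \<tau> where \<tau>: "\<tau> \<in> DN a b"
      "integral {a..b} (\<lambda>s. (deriv_on a b \<tau> s)\<^sup>2 - q s * (\<tau> s)\<^sup>2) < 0" by blast
    then obtain M where M: "M > 0"
      "\<forall>e\<in>{-M..M} - {0}. energy a b A V (\<lambda>s. \<theta> s + e * \<tau> s) < energy a b A V \<theta>"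
      using second_variation_sign(2)[OF assms(1,2) \<theta>C1 DN_crit[OF \<tau>(1)]] by (auto simp: q_def)
    show ?thesis
    proof
      assume "locally_minimal a b A V (DN a b) \<theta>"
      then obtain N where N: "N > 0"
        "\<forall>e\<in>{-N..N} - {0}. energy a b A V (\<lambda>s. \<theta> s + e * \<tau> s) > energy a b A V \<theta>"
        using \<tau>(1) unfolding locally_minimal_def by blast
      have "min M N \<in> {-M..M} - {0}" "min M N \<in> {-N..N} - {0}" using M(1) N(1) by auto
      then show False using M(2) N(2) by (meson less_asym)
    qed
  qed
  have part2: "locally_minimal a b A V (DN a b) \<theta>"
    if J0: "index a b V (phase_traj a b \<theta>) < 0"
  proof -
    have "index a b V (phase_traj a b \<theta>) \<le> -1"
      using J0 by simp
    then have le: "sgn (u a * v a) - sgn (u b * v b) + (\<Sum>z\<in>Z. k z) \<le> -2"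
      using J by linarith
    \<comment> \<open>The signs alone contribute at least \<open>-2\<close>, so nothing is left for the zeros of \<open>u\<close>.\<close>
    have "Z = {}"
    proof (rule ccontr)
      assume "Z \<noteq> {}"
      then have "(\<Sum>z\<in>Z. k z) > 0" using k finZ by (intro sum_pos) auto
      moreover have "sgn (u a * v a) - sgn (u b * v b) \<ge> -2" by (auto simp: sgn_if)
      ultimately show False using le by linarith
    qed
    then have "u s \<noteq> 0" if "s \<in> {a..b}" for s using that by (auto simp: Z_def)
    moreover have "u a * v a < 0" "u b * v b > 0"
    proof -
      have "sgn x - sgn y \<le> -2 \<Longrightarrow> x < 0 \<and> y > 0" for x y :: real
        by (auto simp: sgn_if split: if_splits)
      moreover have "sgn (u a * v a) - sgn (u b * v b) \<le> -2" using le \<open>Z = {}\<close> by simp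
      ultimately show "u a * v a < 0" "u b * v b > 0" by blast+
    qed
    moreover have "(\<tau> has_real_derivative deriv_on a b \<tau> s) (at s within {a..b})"
      if "\<tau> \<in> DN a b" "s \<in> {a..b}" for \<tau> s
      by (rule C1_on_has_deriv[OF DN_crit(1)[OF that(1)] that(2)])
    ultimately have "integral {a..b} (\<lambda>s. (deriv_on a b \<tau> s)\<^sup>2 - q s * (\<tau> s)\<^sup>2) > 0"
      if "\<tau> \<in> DN a b" for \<tau>
      using that C1_on_continuous_deriv[OF DN_crit(1)[OF that]]
      by (intro jacobi_form_pos[OF assms(1) u v _ _ _ _ _ cq]) (auto simp: DN_def)
    then show ?thesis
      unfolding locally_minimal_def
      using second_variation_sign(1)[OF assms(1,2) \<theta>C1 DN_crit] by (simp add: q_def)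
  qed
  show ?thesis using part1 part2 by blast
qed

end
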